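(* Let $F=\{F_n:n\geqslant 2\}=\{1,2,3,5,8,13,\ldots\}$ be the set of Fibonacci numbers. For all integers $a,b\geqslant 6$, we have $p_F(a)\,p_F(b)>p_F(a+b)$.
   Context: $F_n$ denotes the Fibonacci sequence with $F_0=0$, $F_1=1$, $F_{n}=F_{n-1}+F_{n-2}$. The Fibonacci partition function $p_F(n)$ is the number of partitions of $n$ all of whose parts belong to $F$. *)

theory Defs
  imports "HOL-Number_Theory.Fib" "HOL-Library.Multiset"
begin

text \<open>
  A partition of \<open>n\<close> is a multiset of positive integers with sum \<open>n\<close>.
\<close>

definition partitions_in :: "nat set \<Rightarrow> nat \<Rightarrow> nat multiset set" where
  "partitions_in A n = {M. 0 \<notin># M \<and> set_mset M \<subseteq> A \<and> sum_mset M = n}"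

definition partition_count :: "nat set \<Rightarrow> nat \<Rightarrow> nat" where
  "partition_count A n = card (partitions_in A n)"

text \<open>
  Indexing from 2 makes the Fibonacci number 1 a single kind of part.
\<close>

definition fib_parts :: "nat set" where
  "fib_parts = {fib n | n. n \<ge> 2}"

definition p_F :: "nat \<Rightarrow> nat" where
  "p_F n = partition_count fib_parts n"

text \<open>
  The set of partitions is finite, so \<^const>\<open>card\<close> really counts it.
\<close>

lemma finite_partitions_in: "finite (partitions_in A n)"
proof (rule finite_subset)
  show "partitions_in A n \<subseteq> mset ` {xs. set xs \<subseteq> {..n} \<and> length xs \<le> n}"
  proof
    fix M assume M: "M \<in> partitions_in A n"
    obtain xs where xs: "mset xs = M" using ex_mset by blast
    have pos: "0 \<notin> set xs" and sum: "sum_list xs = n"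
      using M xs by (auto simp: partitions_in_def sum_mset_sum_list)
    have "set xs \<subseteq> {..n}"
      using sum member_le_sum_list by fastforce
    moreover have "length xs \<le> sum_list xs"
      using pos by (induction xs) auto
    ultimately show "M \<in> mset ` {xs. set xs \<subseteq> {..n} \<and> length xs \<le> n}"
      using xs sum by blast
  qed
  show "finite (mset ` {xs. set xs \<subseteq> {..n} \<and> length xs \<le> n})"
    by (intro finite_imageI finite_lists_length_le) simp
qed

end

theory Submission
  imports Defs
begin

text \<open>
  Let \<open>q\<close> count partitions into Fibonacci numbers other than 1, so that \<open>p_F n = q 0 + \<dots> + q n\<close>.
  Counting the total size of these partitions part by part gives
  \<open>n q(n) = \<Sum>\<^sub>d d (q(n-d) + q(n-2d) + \<dots>)\<close>. As \<open>q\<close> is almost monotone, each summand is about at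
  most \<open>q 0 + \<dots> + q (n - 1) = p_F (n - 1)\<close>, whence \<open>p_F n \<le> (1 + (k - 1) / n) p_F (n - 1)\<close> for
  \<open>n < F\<^sub>k\<^sub>+\<^sub>1\<close>. Bernoulli's inequality makes this telescope to
  \<open>p_F (a + b) \<le> ((a + b) / b)\<^sup>k\<^sup>-\<^sup>1 p_F b\<close> for \<open>a + b < F\<^sub>k\<^sub>+\<^sub>1\<close>.
  For \<open>F\<^sub>m \<le> a < F\<^sub>m\<^sub>+\<^sub>1\<close> and \<open>a \<le> b\<close> the factor in front of \<open>p_F b\<close> turns out to be at most \<open>2\<^sup>m\<^sup>+\<^sup>1\<close>, the worst case
  being \<open>b\<close> close to \<open>a\<close>, and \<open>p_F a\<close> exceeds \<open>2\<^sup>m\<^sup>+\<^sup>1\<close> as soon as \<open>a \<ge> 37\<close>. For \<open>a \<le> 36\<close> the same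
  bound works when \<open>a + b \<ge> F\<^sub>1\<^sub>1 = 89\<close>, which leaves a finite table.
\<close>

subsection \<open>Partitions with parts in a given set\<close>

lemma sum_mset_eq_sum_count:
  fixes M :: "nat multiset"
  assumes "finite B" "set_mset M \<subseteq> B"
  shows "sum_mset M = (\<Sum>d\<in>B. d * count M d)"
  using assms(2)
proof (induction M)
  case (add x M)
  have "(\<Sum>d\<in>B. d * count (add_mset x M) d) = (\<Sum>d\<in>B. d * count M d + (if d = x then d else 0))"
    by (rule sum.cong) auto
  also have "\<dots> = (\<Sum>d\<in>B. d * count M d) + x"
    using assms(1) add.prems by (simp add: sum.distrib)
  finally show ?case using add by simp
qed simp

lemma partitions_in_containing:
  assumes "d \<in> A" "0 < d" "d \<le> n"
  shows "{M \<in> partitions_in A n. d \<in># M} = add_mset d ` partitions_in A (n - d)"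
proof (intro subset_antisym subsetI)
  fix M assume M: "M \<in> {M \<in> partitions_in A n. d \<in># M}"
  then obtain N where N: "M = add_mset d N" by (metis (mono_tags, lifting) mem_Collect_eq mset_add)
  then show "M \<in> add_mset d ` partitions_in A (n - d)"
    using M by (auto simp: partitions_in_def)
qed (use assms in \<open>auto simp: partitions_in_def\<close>)

lemma partitions_in_avoiding:
  "{M \<in> partitions_in A n. d \<notin># M} = partitions_in (A - {d}) n"
  by (auto simp: partitions_in_def)

lemma partition_part_le:
  assumes "M \<in> partitions_in A n" "d \<in># M"
  shows "d \<le> n"
  using assms by (auto simp: partitions_in_def dest!: multi_member_split)

text \<open>The weight \<open>g\<close> is arbitrary so that one split serves twice: weight 1 gives
  the recurrence for the number of partitions, weight \<open>count M d\<close> the one for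
  occurrences of \<open>d\<close>.\<close>

lemma sum_partitions_split:
  assumes "d \<in> A" "0 < d" "d \<le> n"
  shows "(\<Sum>M\<in>partitions_in A n. g M) =
    (\<Sum>M\<in>partitions_in (A - {d}) n. g M) + (\<Sum>M\<in>partitions_in A (n - d). g (add_mset d M) :: nat)"
proof -
  have "(\<Sum>M\<in>partitions_in A n. g M) =
    (\<Sum>M\<in>{M \<in> partitions_in A n. d \<notin># M}. g M) + (\<Sum>M\<in>{M \<in> partitions_in A n. d \<in># M}. g M)"
    by (subst sum.union_disjoint [symmetric])
      (auto simp: finite_partitions_in intro!: sum.cong)
  also have "(\<Sum>M\<in>{M \<in> partitions_in A n. d \<in># M}. g M) = (\<Sum>M\<in>partitions_in A (n - d). g (add_mset d M))"
    unfolding partitions_in_containing [OF assms] by (subst sum.reindex) (auto intro: inj_onI)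
  finally show ?thesis by (simp only: partitions_in_avoiding)
qed

lemma partition_count_split:
  assumes "d \<in> A" "0 < d" "d \<le> n"
  shows "partition_count A n = partition_count (A - {d}) n + partition_count A (n - d)"
  using sum_partitions_split [OF assms, of "\<lambda>_. 1"] by (simp add: partition_count_def)

lemma partition_count_cong:
  assumes "A \<inter> {1..n} = B \<inter> {1..n}"
  shows "partition_count A n = partition_count B n"
proof -
  have "x \<in> A \<longleftrightarrow> x \<in> B" if "M \<in> partitions_in C n" "x \<in># M" for M x and C :: "nat set"
    using that assms partition_part_le [OF that] by (cases "x = 0") (auto simp: partitions_in_def set_eq_iff)
  then have "partitions_in A n = partitions_in B n"
    by (fastforce simp: partitions_in_def)
  then show ?thesis by (simp add: partition_count_def)
qed

lemma partition_count_diff_large: "n < d \<Longrightarrow> partition_count (A - {d}) n = partition_count A n"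
  by (rule partition_count_cong) auto

lemma partition_count_mono_set: "A \<subseteq> B \<Longrightarrow> partition_count A n \<le> partition_count B n"
  unfolding partition_count_def
  by (rule card_mono [OF finite_partitions_in]) (auto simp: partitions_in_def)

lemma partition_count_add_part:
  assumes "d \<in> A"
  shows "partition_count A n \<le> partition_count A (n + d)"
  using partition_count_split [OF assms, of "n + d"] by (cases "d = 0") auto

lemma partition_count_mono:
  assumes "1 \<in> A" "m \<le> n"
  shows "partition_count A m \<le> partition_count A n"
  using assms(2)
proof (induction n rule: dec_induct)
  case (step n)
  then show ?case using partition_count_add_part [OF assms(1), of n] by simp
qed simp

lemma partition_count_0 [simp]: "partition_count A 0 = 1"
proof -
  have "partitions_in A 0 = {{#}}"
    by (auto simp: partitions_in_def) (metis multiset_nonemptyE)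
  then show ?thesis by (simp add: partition_count_def)
qed

lemma partition_count_empty: "partition_count {} n = (if n = 0 then 1 else 0)"
proof -
  have "partitions_in {} n = {}" if "n > 0" using that by (auto simp: partitions_in_def)
  then show ?thesis by (cases "n = 0") (simp_all add: partition_count_def [of _ n])
qed

section \<open>Double counting the total size of all partitions\<close>

definition part_occurrences :: "nat set \<Rightarrow> nat \<Rightarrow> nat \<Rightarrow> nat" where
  "part_occurrences A d n = (\<Sum>M\<in>partitions_in A n. count M d)"

lemma part_occurrences_rec:
  assumes "d \<in> A" "0 < d" "d \<le> n"
  shows "part_occurrences A d n = partition_count A (n - d) + part_occurrences A d (n - d)"
proof -
  have "(\<Sum>M\<in>partitions_in (A - {d}) n. count M d) = 0"
    by (rule sum.neutral) (auto simp: partitions_in_def count_eq_zero_iff)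
  then show ?thesis
    unfolding part_occurrences_def sum_partitions_split [OF assms]
    by (simp add: sum.distrib sum_Suc partition_count_def)
qed

lemma part_occurrences_large: "n < d \<Longrightarrow> part_occurrences A d n = 0"
  unfolding part_occurrences_def
  by (rule sum.neutral) (auto simp: count_eq_zero_iff dest: partition_part_le)

lemma size_times_partition_count:
  "n * partition_count A n = (\<Sum>d\<in>A \<inter> {1..n}. d * part_occurrences A d n)"
proof -
  have "n * partition_count A n = (\<Sum>M\<in>partitions_in A n. n)"
    by (simp add: partition_count_def)
  also have "\<dots> = (\<Sum>M\<in>partitions_in A n. \<Sum>d\<in>A \<inter> {1..n}. d * count M d)"
  proof (rule sum.cong [OF refl])
    fix M assume M: "M \<in> partitions_in A n"
    have "set_mset M \<subseteq> A \<inter> {1..n}"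
      using M partition_part_le [OF M] by (auto simp: partitions_in_def Suc_le_eq intro!: Nat.gr0I)
    then show "n = (\<Sum>d\<in>A \<inter> {1..n}. d * count M d)"
      using M sum_mset_eq_sum_count [of "A \<inter> {1..n}" M] by (simp add: partitions_in_def)
  qed
  also have "\<dots> = (\<Sum>d\<in>A \<inter> {1..n}. d * part_occurrences A d n)"
    by (subst sum.swap) (simp add: part_occurrences_def sum_distrib_left)
  finally show ?thesis .
qed

text \<open>Monotonicity by 1 fails for partitions without the part 1, but steps of size at least 2
  are sums of the parts 2 and 3.\<close>

lemma partition_count_step_ge_2:
  assumes "2 \<in> A" "3 \<in> A" "m + 2 \<le> n"
  shows "partition_count A m \<le> partition_count A n"
proof -
  have "partition_count A m \<le> partition_count A (m + 2 + k)" for k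
  proof (induction k rule: less_induct)
    case (less k)
    consider "k = 0" | "k = 1" | j where "k = j + 2" by (metis One_nat_def add_2_eq_Suc' not0_implies_Suc)
    then show ?case
    proof cases
      case 3
      then show ?thesis
        using less.IH [of j] partition_count_add_part [OF assms(1), of "m + 2 + j"] by simp
    qed (use partition_count_add_part [OF assms(1), of m] partition_count_add_part [OF assms(2), of m]
        in \<open>simp_all add: numeral_3_eq_3\<close>)
  qed
  from this [of "n - (m + 2)"] show ?thesis using assms(3) by (simp only: le_add_diff_inverse)
qed

text \<open>Induction peels off the last d summands, at m = n - d up to n - 1. All but the one at m
  + 1 are at least q(m) and pay for d - 1 of the d copies of q(m); the remaining copy is the extra
  term on the right. The summand at m + 1 absorbs the extra term of the smaller instance.\<close>

lemma part_occurrences_bound: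
  assumes "2 \<in> A" "3 \<in> A" "d \<in> A" "2 \<le> d" "d \<le> n"
  shows "d * part_occurrences A d n \<le> (\<Sum>i<n. partition_count A i) + partition_count A (n - d)"
  using assms(5)
proof (induction n rule: less_induct)
  case (less n)
  let ?q = "partition_count A"
  define m where "m = n - d"
  have n: "n = m + d" using less.prems m_def by simp
  have rec: "part_occurrences A d n = ?q m + part_occurrences A d m"
    using part_occurrences_rec [of d A n] assms less.prems by (simp add: m_def)
  \<comment> \<open>For \<open>m < d\<close> the default must be 0: truncated subtraction would give
    \<open>?q 0\<close>, which is 1, while \<open>?q (m + 1)\<close> may vanish.\<close>
  have IH: "d * part_occurrences A d m \<le> (\<Sum>i<m. ?q i) + (if d \<le> m then ?q (m - d) else 0)"
  proof (cases "d \<le> m")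
    case True
    then show ?thesis using less.IH [of m] n assms(4) by simp
  qed (simp add: part_occurrences_large)
  have last: "(if d \<le> m then ?q (m - d) else 0) \<le> ?q (m + 1)"
    using partition_count_step_ge_2 [OF assms(1,2), of "m - d" "m + 1"] assms(4) by auto
  obtain e where e: "d = e + 2" using assms(4) by (metis add.commute le_Suc_ex)
  have "(\<Sum>i<n. ?q i) = (\<Sum>i<m+2. ?q i) + (\<Sum>i=m+2..<n. ?q i)"
    using sum.atLeastLessThan_concat [of 0 "m + 2" n ?q] n e by (simp add: atLeast0LessThan del: sum.lessThan_Suc)
  also have "(\<Sum>i<m+2. ?q i) = (\<Sum>i<m. ?q i) + ?q m + ?q (m + 1)"
    by simp
  finally have "(\<Sum>i<n. ?q i) = (\<Sum>i<m. ?q i) + ?q m + ?q (m + 1) + (\<Sum>i=m+2..<n. ?q i)" .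
  moreover have "(\<Sum>i=m+2..<n. ?q i) \<ge> (\<Sum>i=m+2..<n. ?q m)"
    by (rule sum_mono) (use partition_count_step_ge_2 [OF assms(1,2)] in auto)
  moreover have "(\<Sum>i=m+2..<n. ?q m) = e * ?q m" using n e by simp
  moreover have "d * part_occurrences A d n = e * ?q m + 2 * ?q m + d * part_occurrences A d m"
    unfolding rec by (simp add: e algebra_simps)
  ultimately show ?case using IH last unfolding m_def [symmetric] by linarith
qed

text \<open>Each part contributes one full sum. The extra terms, at n - d for distinct parts d, are
  distinct summands of one further copy of that sum, hence the \<open>+ 1\<close>.\<close>

lemma partition_count_increment_bound:
  assumes "2 \<in> A" "3 \<in> A" "1 \<notin> A" "0 < n"
  shows "n * partition_count A n \<le> (card (A \<inter> {2..n}) + 1) * (\<Sum>i<n. partition_count A i)"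
proof -
  let ?q = "partition_count A" and ?B = "A \<inter> {2..n}"
  have "x \<noteq> 1" if "x \<in> A" for x using that assms(3) by blast
  then have B: "A \<inter> {1..n} = ?B" by fastforce
  have "n * ?q n \<le> (\<Sum>d\<in>?B. (\<Sum>i<n. ?q i) + ?q (n - d))"
    unfolding size_times_partition_count B
    by (rule sum_mono) (use assms in \<open>auto intro!: part_occurrences_bound\<close>)
  also have "\<dots> = card ?B * (\<Sum>i<n. ?q i) + (\<Sum>d\<in>?B. ?q (n - d))"
    by (simp add: sum.distrib)
  also have "(\<Sum>d\<in>?B. ?q (n - d)) = sum ?q ((\<lambda>d. n - d) ` ?B)"
    by (subst sum.reindex) (auto intro!: inj_onI)
  also have "\<dots> \<le> (\<Sum>i<n. ?q i)"
    by (rule sum_mono2) (use assms in auto)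
  finally show ?thesis by simp
qed

subsection \<open>Growth of the Fibonacci partition function\<close>

lemma fib_less_Suc: "2 \<le> n \<Longrightarrow> fib n < fib (Suc n)"
  by (cases n rule: fib.cases) (auto simp: fib_neq_0_nat)

lemma fib_less:
  assumes "2 \<le> m" "m < n"
  shows "fib m < fib n"
proof -
  have "fib m < fib (Suc m + j)" for j
    by (induction j) (use assms(1) fib_less_Suc in \<open>auto intro: less_trans simp del: fib.simps\<close>)
  from this [of "n - Suc m"] show ?thesis using assms(2) by (simp del: fib.simps)
qed

lemma three_fib_le: "2 \<le> n \<Longrightarrow> 3 * fib n \<le> 2 * fib (Suc n)"
  by (cases n rule: fib.cases) (use fib_mono [of "n - 2" "n - 1"] in auto)

lemma fib_bracket:
  assumes "2 \<le> m" "fib m \<le> n"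
  obtains k where "m \<le> k" "fib k \<le> n" "n < fib (Suc k)"
proof -
  have bound: "k \<le> n + 2" if "fib k \<le> n" for k
  proof (rule ccontr)
    assume "\<not> k \<le> n + 2"
    have "j < fib (j + 2)" for j
    proof (induction j)
      case (Suc j)
      then show ?case using fib_less_Suc [of "j + 2"] by simp
    qed simp
    then have "n < fib (n + 2)" .
    also have "\<dots> < fib k" using \<open>\<not> k \<le> n + 2\<close> by (intro fib_less) auto
    finally show False using that by simp
  qed
  define k where "k = (GREATEST k. fib k \<le> n)"
  have "fib k \<le> n" unfolding k_def by (rule GreatestI_nat [of _ m "n + 2"]) (use assms bound in auto)
  moreover have "m \<le> k" unfolding k_def by (rule Greatest_le_nat [of _ _ "n + 2"]) (use assms bound in auto)
  moreover have "n < fib (Suc k)"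
  proof (rule ccontr)
    assume "\<not> n < fib (Suc k)"
    then have "Suc k \<le> k" unfolding k_def
      by (intro Greatest_le_nat [of _ _ "n + 2"]) (use bound in auto)
    then show False by simp
  qed
  ultimately show ?thesis using that by blast
qed

lemma fib_in_fib_parts: "2 \<le> k \<Longrightarrow> fib k \<in> fib_parts"
  by (auto simp: fib_parts_def)

lemma one_in_fib_parts: "1 \<in> fib_parts" and two_in_fib_parts: "2 \<in> fib_parts"
  and three_in_fib_parts: "3 \<in> fib_parts"
  using fib_in_fib_parts [of 2] fib_in_fib_parts [of 3] fib_in_fib_parts [of 4]
  by (simp_all add: numeral_eq_Suc)

text \<open>A partition is determined by its parts other than 1: if they add up to i \<le> n,
  exactly n - i ones complete them.\<close>

lemma p_F_eq_sum: "p_F n = (\<Sum>i\<le>n. partition_count (fib_parts - {1}) i)"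
proof (induction n)
  case (Suc n)
  then show ?case
    using partition_count_split [OF one_in_fib_parts, of "Suc n"] by (simp add: p_F_def)
qed (simp add: p_F_def)

lemma card_fib_parts_le:
  assumes "n < fib (Suc k)"
  shows "card ((fib_parts - {1}) \<inter> {2..n}) \<le> k - 2"
proof -
  have "(fib_parts - {1}) \<inter> {2..n} \<subseteq> fib ` {3..k}"
  proof
    fix d assume d: "d \<in> (fib_parts - {1}) \<inter> {2..n}"
    then obtain j where j: "d = fib j" "2 \<le> j" by (auto simp: fib_parts_def)
    have "j \<noteq> 2" using d j by auto
    moreover have "j \<le> k"
    proof (rule ccontr)
      assume "\<not> j \<le> k"
      then have "fib (Suc k) \<le> fib j" by (intro fib_mono) simp
      then show False using d j assms by simp
    qed
    ultimately show "d \<in> fib ` {3..k}" using j by auto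
  qed
  then have "card ((fib_parts - {1}) \<inter> {2..n}) \<le> card (fib ` {3..k})"
    by (intro card_mono) auto
  also have "\<dots> \<le> card {3..k}" by (rule card_image_le) simp
  finally show ?thesis by simp
qed

lemma p_F_growth_step:
  assumes "Suc n < fib (Suc k)" "2 \<le> k"
  shows "Suc n * p_F (Suc n) \<le> (Suc n + (k - 1)) * p_F n"
proof -
  let ?q = "partition_count (fib_parts - {1})"
  have "Suc n * ?q (Suc n) \<le> (card ((fib_parts - {1}) \<inter> {2..Suc n}) + 1) * (\<Sum>i<Suc n. ?q i)"
    using two_in_fib_parts three_in_fib_parts by (intro partition_count_increment_bound) auto
  also have "\<dots> \<le> (k - 1) * p_F n"
    using card_fib_parts_le [OF assms(1)] assms(2)
    by (intro mult_mono) (auto simp: p_F_eq_sum lessThan_Suc_atMost)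
  finally show ?thesis by (simp add: p_F_eq_sum algebra_simps)
qed

lemma p_F_growth:
  assumes "b + a < fib (Suc k)" "2 \<le> k" "0 < b"
  shows "real (p_F (b + a)) * (real b / real (b + a)) ^ (k - 1) \<le> real (p_F b)"
  using assms(1)
proof (induction a)
  case (Suc a)
  define n where "n = b + a"
  have n: "0 < n" using assms(3) by (simp add: n_def)
  let ?M = "k - 1"
  have "real (Suc n * p_F (Suc n)) \<le> real ((Suc n + ?M) * p_F n)"
    using p_F_growth_step [of n k] Suc.prems assms(2) unfolding n_def by (intro of_nat_mono) simp
  then have "real (p_F (Suc n)) \<le> (1 + real ?M * (1 / real (Suc n))) * real (p_F n)"
    by (simp add: field_simps)
  \<comment> \<open>Weakening the denominator from n + 1 to n makes the Bernoulli bound a power of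
    (n + 1)/n, and these ratios telescope.\<close>
  also have "\<dots> \<le> (1 + real ?M * (1 / real n)) * real (p_F n)"
    using n by (intro mult_right_mono add_left_mono mult_left_mono) (auto simp: field_simps)
  also have "\<dots> \<le> (1 + 1 / real n) ^ ?M * real (p_F n)"
    by (intro mult_right_mono Bernoulli_inequality) (auto intro: order_trans [of _ 0])
  also have "1 + 1 / real n = real (Suc n) / real n"
    using n by (simp add: field_simps)
  finally have step: "real (p_F (Suc n)) \<le> (real (Suc n) / real n) ^ ?M * real (p_F n)" .
  have "real (p_F (Suc n)) * (real b / real (Suc n)) ^ ?M
      \<le> (real (Suc n) / real n) ^ ?M * real (p_F n) * (real b / real (Suc n)) ^ ?M"
    using step by (rule mult_right_mono) simp
  also have "\<dots> = real (p_F n) * ((real (Suc n) / real n) * (real b / real (Suc n))) ^ ?M"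
    by (simp only: power_mult_distrib ac_simps)
  also have "(real (Suc n) / real n) * (real b / real (Suc n)) = real b / real n"
    using n by (simp del: of_nat_Suc)
  also have "real (p_F n) * (real b / real n) ^ ?M \<le> real (p_F b)"
    using Suc unfolding n_def by simp
  finally show ?case by (simp add: n_def)
qed (use assms(3) in simp)

text \<open>Since \<open>3 F\<^sub>k \<le> 2 F\<^sub>k\<^sub>+\<^sub>1\<close>, this reduces to \<open>(1 - x)\<^sup>2 \<le> (1 - 2 x / 3)\<^sup>3\<close> for \<open>x = a / F\<^sub>k\<close>.\<close>

lemma tail_factor_Suc:
  assumes "3 \<le> k" "a < fib k"
  shows "(1 - real a / real (fib k)) ^ (k - 1) \<le> (1 - real a / real (fib (Suc k))) ^ k"
proof -
  define x y where "x = real a / real (fib k)" and "y = real a / real (fib (Suc k))"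
  have x: "0 \<le> x" "x < 1" using assms(2) by (auto simp: x_def field_simps)
  have "y \<le> real a / (3 / 2 * real (fib k))"
    unfolding y_def using three_fib_le [of k] assms by (intro divide_left_mono mult_pos_pos) auto
  then have y: "y \<le> 2 * x / 3" by (simp add: x_def)
  have y0: "0 \<le> 1 - y" using x y by simp
  \<comment> \<open>The left-hand side is (1 - 2x/3)^3 - (1 - x)^2; the constant and linear terms
    cancel.\<close>
  have "x\<^sup>2 * (1/3 - 8/27 * x) \<ge> 0" using x by (intro mult_nonneg_nonneg) auto
  then have "(1 - x) ^ 2 \<le> (1 - 2 * x / 3) ^ 3"
    by (simp add: power2_eq_square power3_eq_cube field_simps)
  also have "\<dots> \<le> (1 - y) ^ 3" using x y by (intro power_mono) auto
  finally have cube: "(1 - x) ^ 2 \<le> (1 - y) ^ 3" .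
  \<comment> \<open>Squaring avoids fractional exponents: 2(k - 1) factors 1 - x become 3(k - 1)
    factors 1 - y, and 3(k - 1) \<ge> 2k because k \<ge> 3.\<close>
  have "((1 - x) ^ (k - 1)) ^ 2 = ((1 - x) ^ 2) ^ (k - 1)" by (simp flip: power_mult add: mult.commute)
  also have "\<dots> \<le> ((1 - y) ^ 3) ^ (k - 1)" using cube by (intro power_mono) auto
  also have "\<dots> = (1 - y) ^ (3 * (k - 1))" by (simp add: power_mult)
  also have "\<dots> \<le> (1 - y) ^ (k * 2)"
    using y0 assms(1) by (intro power_decreasing) (auto simp: y_def)
  also have "\<dots> = ((1 - y) ^ k) ^ 2" by (simp add: power_mult)
  finally have "(1 - x) ^ (k - 1) \<le> (1 - y) ^ k"
    by (rule power2_le_imp_le) (use y0 in simp)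
  then show ?thesis by (simp add: x_def y_def)
qed

lemma tail_factor_mono:
  assumes "3 \<le> k" "a < fib k" "k \<le> l"
  shows "(1 - real a / real (fib k)) ^ (k - 1) \<le> (1 - real a / real (fib l)) ^ (l - 1)"
  using assms(3)
proof (induction l rule: dec_induct)
  case (step l)
  have "a < fib l" using assms(2) fib_mono [OF step.hyps(1)] by simp
  then show ?case using tail_factor_Suc [of l a] step assms(1) by simp
qed simp

section \<open>From growth to the product inequality\<close>

text \<open>If F_l \<le> a + b < F_(l+1), the growth bound loses the factor (b/(a+b))^(l-1), which
  is at least (1 - a/F_l)^(l-1). This lower bound does not decrease with l, so the numerical
  condition at k settles every positive b with a + b \<ge> F_k.\<close>

lemma p_F_add_less_tail:
  assumes "3 \<le> k" "a < fib k" "fib k \<le> a + b" "0 < b"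
    and large: "1 < real (p_F a) * (1 - real a / real (fib k)) ^ (k - 1)"
  shows "p_F (a + b) < p_F a * p_F b"
proof -
  obtain l where l: "k \<le> l" "fib l \<le> a + b" "a + b < fib (Suc l)"
    using fib_bracket [of k "a + b"] assms by auto
  have pos: "a < fib l" using assms(2) fib_mono [OF l(1)] by simp
  have "1 - real a / real (fib l) \<le> 1 - real a / real (a + b)"
    using l(2) pos assms(4) by (intro diff_left_mono divide_left_mono mult_pos_pos) auto
  also have "\<dots> = real b / real (b + a)" using assms(4) by (simp add: field_simps)
  finally have "(1 - real a / real (fib l)) ^ (l - 1) \<le> (real b / real (b + a)) ^ (l - 1)"
    using pos by (intro power_mono) (auto simp: field_simps)
  then have "(1 - real a / real (fib k)) ^ (k - 1) \<le> (real b / real (b + a)) ^ (l - 1)"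
    using tail_factor_mono [OF assms(1,2) l(1)] by simp
  then have gt: "1 < real (p_F a) * (real b / real (b + a)) ^ (l - 1)" (is "1 < real (p_F a) * ?r")
    using large by (meson less_le_trans mult_left_mono of_nat_0_le_iff)
  have "1 \<le> p_F (a + b)"
    using partition_count_mono [OF one_in_fib_parts, of 0 "a + b"] by (simp add: p_F_def)
  then have "real (p_F (a + b)) < real (p_F (a + b)) * (real (p_F a) * ?r)"
    using gt by simp
  also have "\<dots> = real (p_F a) * (real (p_F (b + a)) * ?r)" by (simp add: ac_simps)
  also have "\<dots> \<le> real (p_F a) * real (p_F b)"
    using l assms by (intro mult_left_mono p_F_growth) (auto simp: add.commute)
  finally show ?thesis by (simp flip: of_nat_mult)
qed

text \<open>Below F_(m+3) the growth exponent is m + 1 and b/(a+b) \<ge> 1/2, so the loss is at most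
  \<open>2 ^ (m + 1)\<close>. From F_(m+3) on, the tail criterion applies at index m + 3.\<close>

lemma p_F_add_less_dyadic:
  assumes "3 \<le> m" "fib m \<le> a" "a < fib (Suc m)" "a \<le> b" and large: "2 ^ (m + 1) < p_F a"
  shows "p_F (a + b) < p_F a * p_F b"
proof (cases "a + b < fib (m + 3)")
  case True
  have b: "0 < b" using assms fib_neq_0_nat [of m] by simp
  have "real (p_F (a + b)) * (1 / 2) ^ (m + 1) \<le> real (p_F (a + b)) * (real b / real (b + a)) ^ (m + 1)"
    using assms(4) b by (intro mult_left_mono power_mono) (auto simp: field_simps)
  also have "\<dots> \<le> real (p_F b)"
  proof -
    have "b + a < fib (Suc (m + 2))" using True by (simp only: eval_nat_numeral add_Suc_right add.commute)
    from p_F_growth [OF this _ b] show ?thesis by (simp add: add.commute [of a b])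
  qed
  finally have "real (p_F (a + b)) \<le> real (2 ^ (m + 1) * p_F b)"
    by (simp add: power_one_over divide_le_eq mult.commute)
  then have "p_F (a + b) \<le> 2 ^ (m + 1) * p_F b" by (simp only: of_nat_le_iff)
  moreover have "0 < p_F b"
    using partition_count_mono [OF one_in_fib_parts, of 0 b] by (simp add: p_F_def)
  ultimately show ?thesis using mult_less_mono1 [OF large] by (rule_tac le_less_trans)
next
  case False
  let ?F = "fib (m + 3)"
  \<comment> \<open>As F_(m+3) = F_(m+2) + F_(m+1) \<ge> (5/2) F_(m+1), the ratio a/F_(m+3) stays
    below 2/5.\<close>
  have "5 * fib (Suc m) \<le> 2 * ?F"
    using three_fib_le [of "m + 1"] assms(1) by (simp add: numeral_3_eq_3)
  then have "5 * a \<le> 2 * ?F" using assms(3) by simp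
  moreover have F: "0 < ?F" by (simp add: fib_neq_0_nat)
  ultimately have "3 / 5 \<le> 1 - real a / real ?F" by (simp add: field_simps)
  then have r: "(3 / 5) ^ (m + 2) \<le> (1 - real a / real ?F) ^ (m + 2)" by (intro power_mono) auto
  \<comment> \<open>The base 6/5 is 2 * 3/5, joining the bound on \<open>p_F a\<close> to the factor
    3/5; the exponent 5 is the least value of \<open>m + 2\<close>.\<close>
  have "(2::real) \<le> (6 / 5) ^ 5" by (simp add: power_divide)
  also have "\<dots> \<le> (6 / 5) ^ (m + 2)" using assms(1) by (intro power_increasing) auto
  also have "\<dots> = 2 * (2 ^ (m + 1) * (3 / 5) ^ (m + 2))"
  proof -
    have "(6 / 5 :: real) ^ (m + 2) = (2 * (3 / 5)) ^ (m + 2)" by simp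
    then show ?thesis by (simp only: power_mult_distrib) simp
  qed
  finally have "1 \<le> 2 ^ (m + 1) * (3 / 5 :: real) ^ (m + 2)" by linarith
  also have "\<dots> < real (p_F a) * (3 / 5) ^ (m + 2)"
  proof (rule mult_strict_right_mono)
    have "real (2 ^ (m + 1)) < real (p_F a)" using large by (simp only: of_nat_less_iff)
    then show "2 ^ (m + 1) < real (p_F a)" by simp
  qed simp
  also have "\<dots> \<le> real (p_F a) * (1 - real a / real ?F) ^ (m + 2)"
    using r by (intro mult_left_mono) auto
  finally have "1 < real (p_F a) * (1 - real a / real ?F) ^ (m + 2)" .
  moreover have "a < ?F" using assms(3) fib_mono [of "Suc m" "m + 3"] by simp
  moreover have "0 < b" using assms fib_neq_0_nat [of m] by simp
  ultimately show ?thesis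
    using p_F_add_less_tail [of "m + 3" a b] False by simp
qed

subsection \<open>Computation of small values\<close>

fun add_delayed :: "int list \<Rightarrow> int list \<Rightarrow> int list" where
  "add_delayed (w # ws) (x # xs) = (w + x) # add_delayed (ws @ [w + x]) xs"
| "add_delayed _ _ = []"

text \<open>The first argument of \<open>add_delayed\<close> is a queue holding the last \<open>d\<close> values of \<open>g\<close>.\<close>

lemma add_delayed_correct:
  assumes "0 < d" and rec: "\<And>i. g i = f i + (if i < d then 0 else g (i - d))"
  shows "add_delayed (map (\<lambda>j. if j < d then 0 else g (j - d)) [i..<i + d]) (map f [i..<i + l]) =
    map g [i..<i + l]"
proof (induction l arbitrary: i)
  case (Suc l)
  let ?h = "\<lambda>j. if j < d then 0 else g (j - d)"
  have "[i..<i + d] = i # [Suc i..<i + d]" by (rule upt_conv_Cons) (use assms(1) in simp)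
  moreover have "?h i + f i = g i" using rec [of i] by simp
  moreover have "map ?h [Suc i..<i + d] @ [g i] = map ?h [Suc i..<Suc i + d]"
    using assms(1) by (simp add: Suc_le_eq)
  moreover have "[i..<i + Suc l] = i # [Suc i..<Suc i + l]" by (simp add: upt_conv_Cons)
  ultimately show ?case using Suc.IH [of "Suc i"] by (simp del: upt_Suc)
qed simp

text \<open>Coefficients of x^0, ..., x^N in the product of 1/(1 - x^d) over the listed d; a queue
  of d zeros implements one factor.\<close>

primrec partition_row :: "nat \<Rightarrow> nat list \<Rightarrow> int list" where
  "partition_row N [] = 1 # replicate N 0"
| "partition_row N (d # ds) = add_delayed (replicate d 0) (partition_row N ds)"

lemma partition_row_correct:
  assumes "distinct ds" "0 \<notin> set ds"
  shows "partition_row N ds = map (\<lambda>n. int (partition_count (set ds) n)) [0..<Suc N]"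
  using assms
proof (induction ds)
  case Nil
  have "[0..<Suc N] = 0 # [1..<Suc N]" by (simp add: upt_conv_Cons del: upt_Suc)
  moreover have "map (\<lambda>n. int (partition_count {} n)) [1..<Suc N] = replicate N 0"
    by (rule nth_equalityI) (auto simp: partition_count_empty simp del: upt_Suc)
  ultimately show ?case by (simp del: upt_Suc)
next
  case (Cons d ds)
  let ?f = "\<lambda>n. int (partition_count (set ds) n)"
    and ?g = "\<lambda>n. int (partition_count (insert d (set ds)) n)"
  have "?g i = ?f i + (if i < d then 0 else ?g (i - d))" for i
    using partition_count_split [of d "insert d (set ds)" i]
      partition_count_diff_large [of i d "insert d (set ds)"] Cons.prems by auto
  from add_delayed_correct [OF _ this, of 0 "Suc N"] Cons.prems
  have "add_delayed (map (\<lambda>j. if j < d then 0 else ?g (j - d)) [0..<d])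
      (map ?f [0..<Suc N]) = map ?g [0..<Suc N]"
    by (simp del: upt_Suc)
  moreover have "map (\<lambda>j. if j < d then 0 else ?g (j - d)) [0..<d] = replicate d 0"
    by (rule nth_equalityI) auto
  ultimately show ?case using Cons by (simp del: upt_Suc)
qed

lemma partition_count_eq_row:
  assumes "distinct ds" "0 \<notin> set ds" "n \<le> N"
  shows "int (partition_count (set ds) n) = partition_row N ds ! n"
  using assms by (simp add: partition_row_correct del: upt_Suc)

lemma replicate_numeral: "replicate (numeral k) x = x # replicate (pred_numeral k) x"
  by (simp add: numeral_eq_Suc)

lemma fib_image_8: "fib ` {2..8} = set [1, 2, 3, 5, 8, 13, 21]"
proof -
  have "{2..8::nat} = {2, 3, 4, 5, 6, 7, 8}" by auto
  then show ?thesis by (simp add: numeral_eq_Suc)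
qed

lemma fib_image_10: "fib ` {2..10} = set [1, 2, 3, 5, 8, 13, 21, 34, 55]"
proof -
  have "{2..10::nat} = {2, 3, 4, 5, 6, 7, 8, 9, 10}" by auto
  then show ?thesis by (simp add: numeral_eq_Suc)
qed

lemma fib_11: "fib 11 = 89"
  by (simp add: numeral_eq_Suc)

text \<open>The values \<open>p_F 0\<close> to \<open>p_F 88\<close>: all arguments below F_11 = 89,
  for which parts up to F_10 = 55 suffice.\<close>

definition p_F_table :: "int list" where
  "p_F_table =
    [1, 1, 2, 3, 4, 6, 8, 10, 14, 17, 22, 27, 33, 41, 49, 59, 71, 83, 99, 115, 134, 157,
     180, 208, 239, 272, 312, 353, 400, 453, 509, 573, 642, 717, 803, 892, 993, 1102, 1219,
     1350, 1489, 1640, 1808, 1983, 2178, 2386, 2609, 2854, 3113, 3393, 3697, 4017, 4367,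
     4737, 5134, 5564, 6016, 6504, 7025, 7575, 8171, 8797, 9466, 10183, 10936, 11744, 12599,
     13502, 14471, 15486, 16568, 17715, 18921, 20207, 21559, 22987, 24506, 26094, 27782,
     29558, 31425, 33405, 35478, 37664, 39973, 42386, 44939, 47613, 50421]"

lemma p_F_eq_table:
  assumes "n < 89"
  shows "int (p_F n) = p_F_table ! n"
proof -
  have "k \<le> 10" if "fib k \<le> n" for k
  proof (rule ccontr)
    assume "\<not> k \<le> 10"
    then have "fib 11 \<le> fib k" by (intro fib_mono) simp
    then show False using that assms fib_11 by simp
  qed
  then have "fib_parts \<inter> {1..n} = fib ` {2..10} \<inter> {1..n}"
    by (auto simp: fib_parts_def)
  then have "p_F n = partition_count (set [1, 2, 3, 5, 8, 13, 21, 34, 55]) n"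
    unfolding p_F_def fib_image_10 by (rule partition_count_cong)
  also have "int \<dots> = partition_row 88 [1, 2, 3, 5, 8, 13, 21, 34, 55] ! n"
    using assms by (intro partition_count_eq_row) auto
  also have "partition_row 88 [1, 2, 3, 5, 8, 13, 21, 34, 55] = p_F_table"
    by (simp add: p_F_table_def replicate_numeral)
  finally show ?thesis .
qed

section \<open>An exponential lower bound\<close>

text \<open>Split the partitions of F_(k+3) = F_(k+2) + F_(k+1) by whether the new part F_(k+1)
  occurs: each class is at least as large as the previous count, which therefore at least doubles.
  Allowing only parts up to F_k keeps F_(k+1) new.\<close>

lemma fib_partitions_lower_bound:
  assumes "8 \<le> k"
  shows "2 ^ (k + 3) < partition_count (fib ` {2..k}) (fib (k + 2))"
  using assms
proof (induction k rule: dec_induct)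
  case base
  have "int (partition_count (set [1, 2, 3, 5, 8, 13, 21]) 55) = partition_row 55 [1, 2, 3, 5, 8, 13, 21] ! 55"
    by (rule partition_count_eq_row) auto
  also have "\<dots> = 5406" by (simp add: replicate_numeral)
  moreover have "fib 10 = 55" by (simp add: numeral_eq_Suc)
  ultimately show ?case by (simp add: fib_image_8)
next
  case (step k)
  let ?A = "fib ` {2..k}" and ?d = "fib (Suc k)"
  have ins: "fib ` {2..Suc k} = insert ?d ?A"
    using step.hyps by (simp add: atLeastAtMostSuc_conv)
  have "?d \<notin> ?A"
    using fib_less [of _ "Suc k"] by fastforce
  have "1 \<in> ?A" using step.hyps by (intro image_eqI [of _ _ 2]) auto
  have "2 ^ (Suc k + 3) < 2 * partition_count ?A (fib (k + 2))"
    using step.IH by (simp add: power_add del: fib.simps)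
  also have "\<dots> \<le> partition_count ?A (fib (k + 2) + ?d) + partition_count (insert ?d ?A) (fib (k + 2))"
    using partition_count_mono [OF \<open>1 \<in> ?A\<close>, of "fib (k + 2)" "fib (k + 2) + ?d"]
      partition_count_mono_set [OF subset_insertI, of ?A "fib (k + 2)" ?d] by linarith
  also have "\<dots> = partition_count (insert ?d ?A) (fib (k + 2) + ?d)"
    using partition_count_split [of ?d "insert ?d ?A" "fib (k + 2) + ?d"] \<open>?d \<notin> ?A\<close>
    by (simp add: fib_neq_0_nat)
  also have "fib (k + 2) + ?d = fib (Suc k + 2)" by simp
  finally show ?case unfolding ins .
qed

lemma p_F_mono: "m \<le> n \<Longrightarrow> p_F m \<le> p_F n"
  unfolding p_F_def by (rule partition_count_mono [OF one_in_fib_parts])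

lemma p_F_large:
  assumes "10 \<le> m" "fib m \<le> a"
  shows "2 ^ (m + 1) < p_F a"
proof -
  obtain k where m: "m = k + 2" using assms(1) by (intro that [of "m - 2"]) simp
  then have "2 ^ (m + 1) < partition_count (fib ` {2..k}) (fib m)"
    using fib_partitions_lower_bound [of k] assms(1) by (simp add: numeral_3_eq_3 del: fib.simps)
  also have "\<dots> \<le> p_F (fib m)"
    unfolding p_F_def by (rule partition_count_mono_set) (auto simp: fib_parts_def)
  also have "\<dots> \<le> p_F a" using assms(2) by (rule p_F_mono)
  finally show ?thesis .
qed

section \<open>Small cases and conclusion\<close>

text \<open>With b = a + j, position j of the zip pairs the entries at a + b and b; the zip ends at
  a + b = 88.\<close>

lemma p_F_table_products:
  "\<forall>a\<in>set [6..<37]. list_all (\<lambda>(x, y). x < p_F_table ! a * y)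
    (zip (drop (2 * a) p_F_table) (drop a p_F_table))"
  by (simp add: p_F_table_def)

text \<open>The numerical condition of \<open>p_F_add_less_tail\<close> at k = 11, where F_11 = 89,
  with denominators cleared.\<close>

lemma p_F_table_tail:
  "\<forall>a\<in>set [6..<37]. 89 ^ 10 < p_F_table ! a * (89 - int a) ^ 10"
  by (simp add: p_F_table_def)

lemma p_F_add_less_small:
  assumes "6 \<le> a" "a \<le> 36" "a \<le> b"
  shows "p_F (a + b) < p_F a * p_F b"
proof -
  have mem: "a \<in> set [6..<37]" unfolding set_upt using assms by simp
  show ?thesis
  proof (cases "a + b < 89")
    case True
    have len: "length p_F_table = 89" by (simp add: p_F_table_def)
    have "list_all (\<lambda>(x, y). x < p_F_table ! a * y) (zip (drop (2 * a) p_F_table) (drop a p_F_table))"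
      using p_F_table_products mem by (rule bspec)
    moreover have "b - a < length (zip (drop (2 * a) p_F_table) (drop a p_F_table))"
      using True assms(3) by (simp add: len)
    ultimately have "p_F_table ! (2 * a + (b - a)) < p_F_table ! a * p_F_table ! (a + (b - a))"
      using True assms(3) by (fastforce simp: list_all_length len)
    then have "p_F_table ! (a + b) < p_F_table ! a * p_F_table ! b"
      using assms(3) by (simp add: mult_2)
    then have "int (p_F (a + b)) < int (p_F a) * int (p_F b)"
      using True by (simp add: p_F_eq_table)
    then show ?thesis by (simp flip: of_nat_mult)
  next
    case False
    have "89 ^ 10 < p_F_table ! a * (89 - int a) ^ 10"
      using p_F_table_tail mem by (rule bspec)
    then have "89 ^ 10 < int (p_F a) * (89 - int a) ^ 10"
      using assms by (simp only: p_F_eq_table)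
    then have "real_of_int (89 ^ 10) < real_of_int (int (p_F a) * (89 - int a) ^ 10)"
      by (simp only: of_int_less_iff)
    then have "89 ^ 10 < real (p_F a) * (89 - real a) ^ 10" by simp
    moreover have "(1 - real a / 89) ^ 10 = (89 - real a) ^ 10 / 89 ^ 10"
      by (simp only: power_divide [symmetric]) (simp add: diff_divide_distrib)
    ultimately have "1 < real (p_F a) * (1 - real a / 89) ^ 10"
      by (simp add: field_simps)
    then show ?thesis
      using p_F_add_less_tail [of 11 a b] assms False by (simp add: fib_11)
  qed
qed

lemma p_F_add_less_ordered:
  assumes "6 \<le> a" "a \<le> b"
  shows "p_F (a + b) < p_F a * p_F b"
proof -
  have fib_9: "fib 9 = 34" and fib_10: "fib 10 = 55" by (simp_all add: numeral_eq_Suc)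
  consider "a \<le> 36" | "37 \<le> a" "a < 55" | "55 \<le> a" by linarith
  then show ?thesis
  proof cases
    case 1
    then show ?thesis using assms by (intro p_F_add_less_small)
  next
    case 2
    \<comment> \<open>The bound 36 on the table case comes from here: \<open>p_F 36\<close> is 993,
      so 37 is the first argument whose value exceeds 2^10, as needed for m = 9.\<close>
    have "int (p_F 37) = 1102" by (simp add: p_F_eq_table p_F_table_def)
    then have "2 ^ (9 + 1) < p_F a" using p_F_mono [OF 2(1)] by simp
    then show ?thesis
      using 2 assms fib_9 fib_10 by (intro p_F_add_less_dyadic [of 9]) simp_all
  next
    case 3
    then obtain m where "10 \<le> m" "fib m \<le> a" "a < fib (Suc m)"
      using fib_bracket [of 10 a] fib_10 by auto
    then show ?thesis
      using assms p_F_large [of m a] by (intro p_F_add_less_dyadic [of m]) simp_all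
  qed
qed

theorem theorem6p1:
  fixes a b :: nat
  assumes "a \<ge> 6" and "b \<ge> 6"
  shows "p_F a * p_F b > p_F (a + b)"
  using p_F_add_less_ordered [of a b] p_F_add_less_ordered [of b a] assms
  by (cases "a \<le> b") (simp_all add: ac_simps)

end
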